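(* Let $k=\ell r$ with integers $\ell\ge2$, $r\ge2$, and fix $m$ with $2\le m\le\ell$. Let $f=\sum_{j=0}^{r-1}2^{j\ell}c_j:\mathbb{F}_2^n\to\mathbb{Z}_{2^k}$ be a function with $2^\ell$-adic components $c_j:\mathbb{F}_2^n\to\mathbb{Z}_{2^\ell}$. For $F:(\mathbb{Z}_{2^\ell})^{r-1}\to\mathbb{Z}_{2^m}$ let $f_F:\mathbb{F}_2^n\to\mathbb{Z}_{2^\ell}$, $f_F(x)=c_{r-1}(x)+2^{\ell-m}F(c_0(x),\ldots,c_{r-2}(x))$. Suppose $c_{r-1}$ is landscape over $\mathbb{Z}_{2^\ell}$ and that, for every $F=a\cdot\mathbf 1_{\{\alpha^{(0)}\}}$ with $\alpha^{(0)}\in(\mathbb{Z}_{2^\ell})^{r-1}$ and $a\in\{1,2^{m-1}\}$, the function $f_F$ is landscape over $\mathbb{Z}_{2^\ell}$ with $|W_{f_F}(u)|=|W_{c_{r-1}}(u)|$ for all $u\in\mathbb{F}_2^n$. Then $f$ is landscape over $\mathbb{Z}_{2^k}$ with the same levels (as $c_{r-1}$), and $|W_f(u)|=|W_{c_{r-1}}(u)|$ for all $u\in\mathbb{F}_2^n$.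
   Context: Throughout, $n\ge2$ is an even integer, $\zeta_N=e^{2\pi i/N}$, $\langle u,x\rangle=\sum u_ix_i$. For $h:\mathbb{F}_2^n\to\mathbb{Z}_{2^j}$, $W_h(u)=\sum_{x}\zeta_{2^j}^{h(x)}(-1)^{\langle u,x\rangle}$ (the Walsh–Hadamard transform over $\mathbb{Z}_{2^j}$). The $2^\ell$-adic decomposition of $f:\mathbb{F}_2^n\to\mathbb{Z}_{2^k}$, $k=\ell r$, is the unique expression $f=\sum_{j=0}^{r-1}2^{j\ell}c_j$ with digit values $c_j(x)\in\{0,\ldots,2^\ell-1\}$. $\mathbf 1_{\{\alpha^{(0)}\}}$ is the indicator of the point $\alpha^{(0)}$; $2^{\ell-m}F(\cdot)$ is computed in $\mathbb{Z}_{2^\ell}$. $h$ is landscape over $\mathbb{Z}_{2^j}$ if there exist $t\ge1$, integers $m_i\ge0$, odd positive $v_i$ with $\{|W_h(u)|:u\in\mathrm{supp}(W_h)\}=\{2^{m_1/2}v_1,\ldots,2^{m_t/2}v_t\}$; the pairs $(m_i,v_i)$ are its levels. *)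

theory Defs
  imports "HOL-Analysis.Analysis" "HOL-Library.Z2"
begin

text \<open>
  Conventions: \<open>\<F>\<^sub>2\<^sup>n\<close> is \<^typ>\<open>bit ^ 'n\<close>; an element of \<open>\<int>\<close> modulo \<open>2\<^sup>j\<close> is its
  representative in \<open>{0, \<dots>, 2\<^sup>j - 1}\<close>, of type \<^typ>\<open>nat\<close>.
\<close>

instance bit :: finite
proof
  have "(UNIV :: bit set) = {0, 1}"
    by (auto intro: bit.exhaust)
  then show "finite (UNIV :: bit set)"
    by (metis finite.emptyI finite_insert)
qed

definition zeta :: "nat \<Rightarrow> complex" where
  "zeta N = exp (2 * complex_of_real pi * \<i> / of_nat N)"

definition walsh :: "nat \<Rightarrow> (bit ^ 'n \<Rightarrow> nat) \<Rightarrow> bit ^ 'n \<Rightarrow> complex" where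
  "walsh j h u = (\<Sum>x\<in>UNIV. zeta (2 ^ j) ^ h x * (- 1) ^ (of_bit (scalar_product u x) :: nat))"

text \<open>
  \<open>L\<close> is the set of level pairs \<open>(m\<^sub>i, v\<^sub>i)\<close>. It is determined by \<open>h\<close>, since
  \<open>2\<^sup>m v\<^sup>2\<close> with \<open>v\<close> odd determines \<open>m\<close> and \<open>v\<close>.
\<close>

definition landscape_with_levels :: "nat \<Rightarrow> (bit ^ 'n \<Rightarrow> nat) \<Rightarrow> (nat \<times> nat) set \<Rightarrow> bool" where
  "landscape_with_levels j h L \<longleftrightarrow>
     finite L \<and> L \<noteq> {} \<and> (\<forall>(m, v)\<in>L. odd v) \<and>
     {cmod (walsh j h u) | u. walsh j h u \<noteq> 0} = (\<lambda>(m, v). 2 powr (real m / 2) * real v) ` L"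

definition landscape :: "nat \<Rightarrow> (bit ^ 'n \<Rightarrow> nat) \<Rightarrow> bool" where
  "landscape j h \<longleftrightarrow> (\<exists>L. landscape_with_levels j h L)"

text \<open>The sum is below \<open>2\<^bsup>l * r\<^esup>\<close>, so no reduction modulo \<open>2\<^bsup>l * r\<^esup>\<close> is needed.\<close>

definition adic_decomposition ::
  "nat \<Rightarrow> nat \<Rightarrow> (bit ^ 'n \<Rightarrow> nat) \<Rightarrow> (nat \<Rightarrow> bit ^ 'n \<Rightarrow> nat) \<Rightarrow> bool" where
  "adic_decomposition l r f c \<longleftrightarrow>
     (\<forall>j<r. \<forall>x. c j x < 2 ^ l) \<and> (\<forall>x. f x = (\<Sum>j<r. 2 ^ (j * l) * c j x))"

definition tuples :: "nat \<Rightarrow> nat \<Rightarrow> nat list set" where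
  "tuples l s = {\<alpha>. length \<alpha> = s \<and> set \<alpha> \<subseteq> {..<2 ^ l}}"

definition f_perturbed ::
  "nat \<Rightarrow> nat \<Rightarrow> nat \<Rightarrow> (nat \<Rightarrow> bit ^ 'n \<Rightarrow> nat) \<Rightarrow> (nat list \<Rightarrow> nat) \<Rightarrow> bit ^ 'n \<Rightarrow> nat" where
  "f_perturbed l r m c F x =
     (c (r - 1) x + 2 ^ (l - m) * F (map (\<lambda>j. c j x) [0..<r - 1])) mod 2 ^ l"

end

theory Submission
  imports Defs
begin

text \<open>
  Fix \<open>u\<close> and split \<open>W = W_c(u)\<close>, for \<open>c = c_{r-1}\<close>, as the sum of the pieces \<open>S \<alpha>\<close> contributed by
  the fibres of \<open>(c_0, \<dots>, c_{r-2})\<close>. Perturbing by an indicator multiplies one piece by \<open>-1\<close> or by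
  \<open>\<omega> = \<zeta>\<close> of order \<open>2^m\<close>. Invariance of the modulus under \<open>-1\<close> says that the real part of
  \<open>S \<alpha> * cnj W\<close> is \<open>\<bar>S \<alpha>\<bar>\<^sup>2\<close>, and invariance under the non-real \<open>\<omega>\<close> that its imaginary part vanishes;
  together these force \<open>S \<alpha> \<in> {0, W}\<close>. Hence a single fibre carries all of \<open>W\<close>, and \<open>W_f(u)\<close>
  differs from \<open>W\<close> only by the unimodular weight of that fibre.
\<close>

lemma piece_zero_or_total:
  fixes S W \<omega> :: complex
  assumes "cmod \<omega> = 1" and "Im \<omega> \<noteq> 0"
    and neg: "cmod (W - 2 * S) = cmod W"
    and rot: "cmod (W + (\<omega> - 1) * S) = cmod W"
  shows "S = 0 \<or> S = W"
proof -
  obtain a b where S: "S = Complex a b" by (cases S)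
  obtain p q where W: "W = Complex p q" by (cases W)
  obtain s t where \<omega>: "\<omega> = Complex s t" by (cases \<omega>)
  have st: "s\<^sup>2 + t\<^sup>2 = 1"
    using assms(1) unfolding \<omega> by (simp add: cmod_def)
  have "(cmod (W - 2 * S))\<^sup>2 = (cmod W)\<^sup>2"
    using neg by simp
  then have re: "a\<^sup>2 + b\<^sup>2 = a * p + b * q"
    unfolding S W cmod_power2 by (simp add: power2_eq_square algebra_simps)
  have "(cmod (W + (\<omega> - 1) * S))\<^sup>2 = (cmod W)\<^sup>2"
    using rot by simp
  then have "(p + ((s - 1) * a - t * b))\<^sup>2 + (q + ((s - 1) * b + t * a))\<^sup>2 = p\<^sup>2 + q\<^sup>2"
    unfolding S W \<omega> cmod_power2 by simp
  \<comment> \<open>By \<open>st\<close>, |\<omega> - 1|^2 = 2 - 2s. With \<open>re\<close> the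
    terms carrying s - 1 cancel, leaving twice t times the imaginary part of
    \<open>W * cnj S\<close>.\<close>
  then have "t * (a * q - b * p) = 0"
    using re st by algebra
  then have im: "a * q = b * p"
    using assms(2) \<omega> by simp
  show ?thesis
  proof (cases "a\<^sup>2 + b\<^sup>2 = 0")
    case True
    then show ?thesis unfolding S by (simp add: complex_eq_iff)
  next
    case False
    \<comment> \<open>Real and imaginary parts of |S|^2 (S - W) = 0, which is
      \<open>cnj S * W\<close> = |S|^2 multiplied by S.\<close>
    have "(a\<^sup>2 + b\<^sup>2) * (a - p) = 0" and "(a\<^sup>2 + b\<^sup>2) * (b - q) = 0"
      using re im by algebra+
    then show ?thesis
      using False unfolding S W by auto
  qed
qed

text \<open>If the total vanishes, so does every piece. Otherwise the nonzero pieces all equal the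
  total, so there is exactly one, and its weight does not change the modulus.\<close>

lemma cmod_weighted_sum_eq:
  fixes S g :: "'a \<Rightarrow> complex"
  assumes "finite T" and "\<And>\<alpha>. \<alpha> \<in> T \<Longrightarrow> S \<alpha> = 0 \<or> S \<alpha> = sum S T"
    and "\<And>\<alpha>. \<alpha> \<in> T \<Longrightarrow> cmod (g \<alpha>) = 1"
  shows "cmod (\<Sum>\<alpha>\<in>T. g \<alpha> * S \<alpha>) = cmod (sum S T)"
proof (cases "sum S T = 0")
  case True
  then have "(\<Sum>\<alpha>\<in>T. g \<alpha> * S \<alpha>) = 0"
    using assms(2) by (intro sum.neutral) auto
  then show ?thesis using True by simp
next
  case False
  define W where "W = sum S T"
  define A where "A = {\<alpha> \<in> T. S \<alpha> \<noteq> 0}"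
  have A: "finite A" "A \<subseteq> T" "\<And>\<alpha>. \<alpha> \<in> A \<Longrightarrow> S \<alpha> = W"
    using assms(1,2) by (auto simp: A_def W_def)
  have "W = sum S A"
    unfolding W_def using assms(1) A_def by (intro sum.mono_neutral_right) auto
  also have "\<dots> = of_nat (card A) * W"
    using A(3) by simp
  finally have "card A = 1"
    using False W_def by simp
  then obtain \<beta> where \<beta>: "A = {\<beta>}" by (auto simp: card_1_singleton_iff)
  have "(\<Sum>\<alpha>\<in>T. g \<alpha> * S \<alpha>) = (\<Sum>\<alpha>\<in>A. g \<alpha> * S \<alpha>)"
    using assms(1) A_def by (intro sum.mono_neutral_right) auto
  also have "\<dots> = g \<beta> * W"
    using A(3) \<beta> by simp
  finally show ?thesis
    using assms(3)[of \<beta>] A(2) \<beta> by (simp add: norm_mult W_def)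
qed

lemma cmod_zeta [simp]: "cmod (zeta N) = 1"
  by (simp add: zeta_def norm_exp_eq_Re)

lemma zeta_pow_self: "N > 0 \<Longrightarrow> zeta N ^ N = 1"
  by (simp add: zeta_def flip: exp_of_nat_mult)

lemma zeta_pow_mod:
  assumes "N > 0"
  shows "zeta N ^ (a mod N) = zeta N ^ a"
proof -
  have "zeta N ^ a = zeta N ^ (N * (a div N) + a mod N)"
    by simp
  also have "\<dots> = zeta N ^ (a mod N)"
    unfolding power_add power_mult zeta_pow_self[OF assms] by simp
  finally show ?thesis by simp
qed

lemma zeta_mult_pow: "a > 0 \<Longrightarrow> zeta (a * b) ^ a = zeta b"
  by (simp add: zeta_def flip: exp_of_nat_mult)

lemma zeta_two: "zeta 2 = - 1"
  by (simp add: zeta_def mult.commute)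

lemma Im_zeta_pos:
  assumes "N > 2"
  shows "Im (zeta N) > 0"
proof -
  have "zeta N = cis (2 * pi / real N)"
    unfolding zeta_def cis_conv_exp by (simp add: mult_ac)
  moreover have "sin (2 * pi / real N) > 0"
    using assms by (intro sin_gt_zero) (auto simp: field_simps)
  ultimately show ?thesis by simp
qed

text \<open>The moduli also determine the support, as the set where they are nonzero.\<close>

lemma landscape_with_levels_cong:
  assumes "\<And>u. cmod (walsh j g u) = cmod (walsh i h u)"
  shows "landscape_with_levels j g L \<longleftrightarrow> landscape_with_levels i h L"
proof -
  have "walsh j g u \<noteq> 0 \<longleftrightarrow> walsh i h u \<noteq> 0" for u
    using assms[of u] by (metis norm_eq_zero)
  then show ?thesis
    unfolding landscape_with_levels_def using assms by simp
qed

definition low_digits :: "nat \<Rightarrow> (nat \<Rightarrow> bit ^ 'n \<Rightarrow> nat) \<Rightarrow> bit ^ 'n \<Rightarrow> nat list" where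
  "low_digits r c x = map (\<lambda>j. c j x) [0..<r - 1]"

definition walsh_piece :: "nat \<Rightarrow> nat \<Rightarrow> (nat \<Rightarrow> bit ^ 'n \<Rightarrow> nat) \<Rightarrow> bit ^ 'n \<Rightarrow> nat list \<Rightarrow> complex" where
  "walsh_piece l r c u \<alpha> = (\<Sum>x | low_digits r c x = \<alpha>.
     zeta (2 ^ l) ^ c (r - 1) x * (- 1) ^ (of_bit (scalar_product u x) :: nat))"

text \<open>A weight depending only on the low digits is constant on each fibre. The choice of
  \<open>g\<close> yields the transform of the top digit, of \<open>f\<close>, or of a
  perturbation.\<close>

lemma sum_weighted_walsh_pieces:
  "(\<Sum>\<alpha>\<in>range (low_digits r c). g \<alpha> * walsh_piece l r c u \<alpha>) =
   (\<Sum>x\<in>UNIV. g (low_digits r c x) *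
      (zeta (2 ^ l) ^ c (r - 1) x * (- 1) ^ (of_bit (scalar_product u x) :: nat)))"
proof -
  have "(\<Sum>\<alpha>\<in>range (low_digits r c). g \<alpha> * walsh_piece l r c u \<alpha>) =
    (\<Sum>\<alpha>\<in>range (low_digits r c). \<Sum>x\<in>{x \<in> UNIV. low_digits r c x = \<alpha>}. g (low_digits r c x) *
      (zeta (2 ^ l) ^ c (r - 1) x * (- 1) ^ (of_bit (scalar_product u x) :: nat)))"
    unfolding walsh_piece_def sum_distrib_left by (intro sum.cong) auto
  also have "\<dots> = (\<Sum>x\<in>UNIV. g (low_digits r c x) *
      (zeta (2 ^ l) ^ c (r - 1) x * (- 1) ^ (of_bit (scalar_product u x) :: nat)))"
    by (intro sum.group) auto
  finally show ?thesis .
qed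

lemma walsh_top_digit:
  "walsh l (c (r - 1)) u = sum (walsh_piece l r c u) (range (low_digits r c))"
  using sum_weighted_walsh_pieces[where g = "\<lambda>_. 1" and l = l and r = r and c = c and u = u]
  by (simp add: walsh_def)

text \<open>Raising the root of order \<open>2^(l * r)\<close> to the place value of the top digit
  gives \<open>zeta (2 ^ l)\<close>. The remaining digits are fixed on a fibre and form its
  weight.\<close>

lemma walsh_adic:
  assumes "adic_decomposition l r f c" and "r \<ge> 1"
  shows "walsh (l * r) f u = (\<Sum>\<alpha>\<in>range (low_digits r c).
    zeta (2 ^ (l * r)) ^ (\<Sum>j<r - 1. 2 ^ (j * l) * \<alpha> ! j) * walsh_piece l r c u \<alpha>)"
  unfolding sum_weighted_walsh_pieces walsh_def
proof (rule sum.cong[OF refl])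
  fix x
  obtain s where r: "r = Suc s"
    using assms(2) by (cases r) auto
  have "f x = (\<Sum>j<s. 2 ^ (j * l) * c j x) + 2 ^ (s * l) * c s x"
    using assms(1) unfolding adic_decomposition_def r by simp
  moreover have "zeta (2 ^ (l * r)) ^ 2 ^ (s * l) = zeta (2 ^ l)"
    using zeta_mult_pow[of "2 ^ (s * l)" "2 ^ l"]
    by (simp add: r power_add[symmetric] algebra_simps)
  moreover have "(\<Sum>j<r - 1. 2 ^ (j * l) * low_digits r c x ! j) = (\<Sum>j<s. 2 ^ (j * l) * c j x)"
    by (intro sum.cong) (auto simp: low_digits_def r)
  ultimately show "zeta (2 ^ (l * r)) ^ f x * (- 1) ^ (of_bit (scalar_product u x) :: nat) =
    zeta (2 ^ (l * r)) ^ (\<Sum>j<r - 1. 2 ^ (j * l) * low_digits r c x ! j) *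
      (zeta (2 ^ l) ^ c (r - 1) x * (- 1) ^ (of_bit (scalar_product u x) :: nat))"
    by (simp add: r power_add power_mult)
qed

text \<open>The factor \<open>2 ^ (l - m)\<close> turns \<open>zeta (2 ^ l)\<close> into
  \<open>zeta (2 ^ m)\<close>, so only the piece at \<beta> is rescaled. Reduction modulo
  \<open>2 ^ l\<close> is absorbed by periodicity.\<close>

lemma walsh_perturbed:
  assumes "m \<le> l" and "\<beta> \<in> range (low_digits r c)"
  shows "walsh l (f_perturbed l r m c (\<lambda>\<alpha>. a * indicator {\<beta>} \<alpha>)) u =
    walsh l (c (r - 1)) u + (zeta (2 ^ m) ^ a - 1) * walsh_piece l r c u \<beta>"
proof -
  let ?g = "\<lambda>\<alpha>. if \<alpha> = \<beta> then zeta (2 ^ m) ^ a else 1"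
  have z: "zeta (2 ^ l) ^ 2 ^ (l - m) = zeta (2 ^ m)"
    using zeta_mult_pow[of "2 ^ (l - m)" "2 ^ m"] assms(1)
    by (simp add: power_add[symmetric])
  have "walsh l (f_perturbed l r m c (\<lambda>\<alpha>. a * indicator {\<beta>} \<alpha>)) u =
    (\<Sum>\<alpha>\<in>range (low_digits r c). ?g \<alpha> * walsh_piece l r c u \<alpha>)"
    unfolding sum_weighted_walsh_pieces walsh_def f_perturbed_def low_digits_def[symmetric]
    by (intro sum.cong) (simp_all add: zeta_pow_mod power_add power_mult z)
  also have "\<dots> = (\<Sum>\<alpha>\<in>range (low_digits r c). walsh_piece l r c u \<alpha> +
      (if \<alpha> = \<beta> then (zeta (2 ^ m) ^ a - 1) * walsh_piece l r c u \<alpha> else 0))"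
    by (intro sum.cong) (auto simp: algebra_simps)
  also have "\<dots> = walsh l (c (r - 1)) u + (zeta (2 ^ m) ^ a - 1) * walsh_piece l r c u \<beta>"
    using assms(2) unfolding walsh_top_digit by (simp add: sum.distrib)
  finally show ?thesis .
qed

theorem theorem4p7:
  fixes f :: "bit ^ 'n \<Rightarrow> nat"
    and c :: "nat \<Rightarrow> bit ^ 'n \<Rightarrow> nat"
    and k l r m :: nat
  assumes "CARD('n) \<ge> 2" and "even CARD('n)"
    and "l \<ge> 2" and "r \<ge> 2" and "k = l * r"
    and "2 \<le> m" and "m \<le> l"
    and "\<And>x. f x < 2 ^ k"
    and "adic_decomposition l r f c"
    and "landscape l (c (r - 1))"
    and "\<And>F a \<alpha>0. \<alpha>0 \<in> tuples l (r - 1) \<Longrightarrow> a \<in> {1, 2 ^ (m - 1)} \<Longrightarrow>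
           F = (\<lambda>\<alpha>. a * indicator {\<alpha>0} \<alpha>) \<Longrightarrow>
           landscape l (f_perturbed l r m c F) \<and>
           (\<forall>u. cmod (walsh l (f_perturbed l r m c F) u) = cmod (walsh l (c (r - 1)) u))"
  shows "landscape k f \<and>
    (\<forall>L. landscape_with_levels k f L \<longleftrightarrow> landscape_with_levels l (c (r - 1)) L) \<and>
    (\<forall>u. cmod (walsh k f u) = cmod (walsh l (c (r - 1)) u))"
proof -
  \<comment> \<open>Since m \<ge> 2, the root has order at least 4 and is not real.\<close>
  have "(2::nat) ^ 2 \<le> 2 ^ m"
    using assms(6) by (intro power_increasing) auto
  then have Im: "Im (zeta (2 ^ m)) \<noteq> 0"
    using Im_zeta_pos[of "2 ^ m"] by simp
  have half: "zeta (2 ^ m) ^ 2 ^ (m - 1) = - 1"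
    using zeta_mult_pow[of "2 ^ (m - 1)" 2] assms(6)
    by (simp add: zeta_two power_Suc2[symmetric])
  have pieces: "walsh_piece l r c u \<beta> = 0 \<or> walsh_piece l r c u \<beta> = walsh l (c (r - 1)) u"
    if \<beta>: "\<beta> \<in> range (low_digits r c)" for u \<beta>
  proof -
    \<comment> \<open>Digits lie below \<open>2 ^ l\<close>, so every fibre label is an admissible
      centre for the indicator.\<close>
    have "\<beta> \<in> tuples l (r - 1)"
      using \<beta> assms(4,9) by (auto simp: tuples_def low_digits_def adic_decomposition_def)
    then have rot: "cmod (walsh l (c (r - 1)) u + (zeta (2 ^ m) ^ a - 1) * walsh_piece l r c u \<beta>) =
        cmod (walsh l (c (r - 1)) u)" if "a \<in> {1, 2 ^ (m - 1)}" for a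
      using assms(11)[OF _ that refl] walsh_perturbed[OF assms(7) \<beta>] by metis
    show ?thesis
      \<comment> \<open>a = 1 supplies the non-real rotation, and a = \<open>2 ^ (m - 1)\<close> the
        sign change.\<close>
      using rot[of 1] rot[of "2 ^ (m - 1)"] Im half
      by (intro piece_zero_or_total[of "zeta (2 ^ m)"]) auto
  qed
  \<comment> \<open>The fibre weights are powers of a root of unity, hence unimodular.\<close>
  have abs: "cmod (walsh k f u) = cmod (walsh l (c (r - 1)) u)" for u
    unfolding assms(5) walsh_adic[OF assms(9) order.trans[OF one_le_numeral assms(4)]] walsh_top_digit
    using pieces[unfolded walsh_top_digit]
    by (intro cmod_weighted_sum_eq) (auto simp: norm_power)
  have "landscape_with_levels k f L \<longleftrightarrow> landscape_with_levels l (c (r - 1)) L" for L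
    using abs by (rule landscape_with_levels_cong)
  then show ?thesis
    using abs assms(10) unfolding landscape_def by blast
qed

end
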